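(* Let $\mathcal X$ be an RD-space, let $\rho$ be an admissible function on $\mathcal X$, and let $K_\rho:\mathcal X\times\mathcal X\to[0,\infty)$ be a measurable kernel for which there is a positive constant $C_5$ such that, for all $x,y\in\mathcal X$: (K)$_1$ $K_\rho(x,y)=0$ if $d(x,y)>C_5\min\{\rho(x),\rho(y)\}$; (K)$_2$ $K_\rho(x,y)\le C_5\frac1{\mu(B(x,\rho(x)))+\mu(B(y,\rho(y)))}$; (K)$_3$ $K_\rho(x,y)=K_\rho(y,x)$; (K)$_4$ $\int_{\mathcal X}K_\rho(x,y)\,d\mu(x)=1$ for all $y$. Put $K_\rho(f)(x)=\int_{\mathcal X}K_\rho(x,y)f(y)\,d\mu(y)$. Then: (i) $\mathrm{BMO}_\rho(\mathcal X)=\{b\in\mathrm{BMO}(\mathcal X):\ K_\rho(b)\in L^\infty(\mathcal X)\}$; moreover, there is a constant $C\ge1$ such that for all $b\in\mathrm{BMO}_\rho(\mathcal X)$, $$C^{-1}\|b\|_{\mathrm{BMO}_\rho(\mathcal X)}\le\|K_\rho(b)\|_{L^\infty(\mathcal X)}+\|b\|_{\mathrm{BMO}(\mathcal X)}\le C\|b\|_{\mathrm{BMO}_\rho(\mathcal X)}.$$ (ii) If $f\in\mathrm{BMO}(\mathcal X)$, then $f-K_\rho(f)\in\mathrm{BMO}_\rho(\mathcal X)$; moreover, there exists a positive constant $C$ such that for all $f\in\mathrm{BMO}(\mathcal X)$, $\|f-K_\rho(f)\|_{\mathrm{BMO}_\rho(\mathcal X)}\le C\|f\|_{\mathrm{BMO}(\mathcal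 X)}$.
   Context: RD-space: $(\mathcal X,d)$ is a metric space with a regular Borel measure $\mu$ such that all balls $B(x,r)=\{y: d(x,y)<r\}$ have finite and positive measure; $\mu$ is doubling, i.e. there is $A_1\ge1$ with $\mu(B(x,2r))\le A_1\mu(B(x,r))$ for all $x\in\mathcal X$, $r>0$; and there are $0<\kappa\le n$, $A_2\in(0,1]$, $A_3\in[1,\infty)$ such that $A_2\lambda^\kappa\mu(B(x,r))\le\mu(B(x,\lambda r))\le A_3\lambda^n\mu(B(x,r))$ for all $x\in\mathcal X$, $0<r\le \mathrm{diam}(\mathcal X)/2$ and $1\le\lambda\le \mathrm{diam}(\mathcal X)/(2r)$. Balls are understood together with their center and radius. Admissible function: $\rho:\mathcal X\to(0,\infty)$ is admissible if there are positive constants $C_0,k_0$ such that $\frac1{\rho(x)}\le C_0\frac1{\rho(y)}\left(1+\frac{d(x,y)}{\rho(y)}\right)^{k_0}$ for all $x,y\in\mathcal X$. For $f\in L^1_{\rm loc}(\mathcal X)$ (integrable on every ball), $f_B=\frac1{\mu(B)}\int_B f\,d\mu$. $\mathrm{BMO}(\mathcal X)$ is the set of $f\in L^1_{\rm loc}(\mathcal X)$ with $\|f\|_{\mathrm{BMO}(\mathcal X)}=\sup_B\frac1{\mu(B)}\int_B|f-f_B|\,d\mu<\infty$ (supremum over all balls). Let $\mathcal D$ be the collection of balls $B(x,r)$ with $r\ge\rho(x)$. $\mathrm{BMO}_\rho(\mathcal X)$ is the set of $f\in L^1_{\rm loc}(\mathcal X)$ with $$\|f\|_{\mathrm{BMO}_\rho(\mathcal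 X)}=\sup_{B\notin\mathcal D}\frac1{\mu(B)}\int_B|f-f_B|\,d\mu+\sup_{B\in\mathcal D}\frac1{\mu(B)}\int_B|f|\,d\mu<\infty.$$ *)

theory Defs
  imports "HOL-Analysis.Analysis" "HOL-Probability.Essential_Supremum"
begin

section \<open>RD-spaces\<close>

text \<open>Inner approximation is by closed sets, because the underlying metric space need not be
  complete.  Regularity with compact sets inside, as well as Borel regularity of the induced outer
  measure when balls have finite measure, implies this condition.\<close>

definition regular_borel :: "'a::metric_space measure \<Rightarrow> bool" where
  "regular_borel M \<longleftrightarrow> sets M = sets borel \<and>
     (\<forall>A\<in>sets M.
        emeasure M A = (INF U\<in>{U. open U \<and> A \<subseteq> U}. emeasure M U) \<and>
        emeasure M A = (SUP F\<in>{F. closed F \<and> F \<subseteq> A}. emeasure M F))"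

text \<open>Extended-valued, since the library's \<open>diameter\<close> is real-valued and is not meaningful for
  unbounded spaces.\<close>

definition ediam :: "'a::metric_space itself \<Rightarrow> ennreal" where
  "ediam _ = (SUP x::'a. SUP y::'a. ennreal (dist x y))"

definition rd_space :: "'a::metric_space measure \<Rightarrow> bool" where
  "rd_space M \<longleftrightarrow>
     regular_borel M \<and>
     (\<forall>x. \<forall>r>0. 0 < emeasure M (ball x r) \<and> emeasure M (ball x r) < \<infinity>) \<and>
     (\<exists>A1::real. A1 \<ge> 1 \<and>
        (\<forall>x. \<forall>r>0. measure M (ball x (2 * r)) \<le> A1 * measure M (ball x r))) \<and>
     (\<exists>\<kappa> n A2 A3 :: real. 0 < \<kappa> \<and> \<kappa> \<le> n \<and> 0 < A2 \<and> A2 \<le> 1 \<and> 1 \<le> A3 \<and>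
        (\<forall>x r l. 0 < r \<and> ennreal r \<le> ediam TYPE('a) / 2 \<and>
                 1 \<le> l \<and> ennreal l \<le> ediam TYPE('a) / ennreal (2 * r) \<longrightarrow>
           A2 * l powr \<kappa> * measure M (ball x r) \<le> measure M (ball x (l * r)) \<and>
           measure M (ball x (l * r)) \<le> A3 * l powr n * measure M (ball x r)))"

definition admissible :: "('a::metric_space \<Rightarrow> real) \<Rightarrow> bool" where
  "admissible \<rho> \<longleftrightarrow> (\<forall>x. 0 < \<rho> x) \<and>
     (\<exists>C0 k0 :: real. 0 < C0 \<and> 0 < k0 \<and>
        (\<forall>x y. 1 / \<rho> x \<le> C0 * (1 / \<rho> y) * (1 + dist x y / \<rho> y) powr k0))"

section \<open>Function spaces\<close>

text \<open>The sort \<open>{real_normed_field, euclidean_space}\<close> of the values stands for the scalar field: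
  the reals and the complex numbers are its instances.  Elements of the function spaces are
  functions rather than classes modulo almost everywhere equality; all norms take values in
  \<open>ennreal\<close>.\<close>

definition L1_loc ::
  "'a::metric_space measure \<Rightarrow> ('a \<Rightarrow> 'b::{real_normed_field, euclidean_space}) set" where
  "L1_loc M = {f \<in> borel_measurable M. \<forall>x. \<forall>r>0. set_integrable M (ball x r) f}"

definition avg ::
  "'a measure \<Rightarrow> ('a \<Rightarrow> 'b::{real_normed_field, euclidean_space}) \<Rightarrow> 'a set \<Rightarrow> 'b" where
  "avg M f B = (1 / measure M B) *\<^sub>R (LINT y:B|M. f y)"

definition mean_abs ::
  "'a measure \<Rightarrow> ('a \<Rightarrow> 'b::{real_normed_field, euclidean_space}) \<Rightarrow> 'a set \<Rightarrow> ennreal" where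
  "mean_abs M f B = (1 / emeasure M B) * (\<integral>\<^sup>+y\<in>B. ennreal (norm (f y)) \<partial>M)"

definition mean_osc ::
  "'a measure \<Rightarrow> ('a \<Rightarrow> 'b::{real_normed_field, euclidean_space}) \<Rightarrow> 'a set \<Rightarrow> ennreal" where
  "mean_osc M f B = mean_abs M (\<lambda>y. f y - avg M f B) B"

definition BMO_norm ::
  "'a::metric_space measure \<Rightarrow> ('a \<Rightarrow> 'b::{real_normed_field, euclidean_space}) \<Rightarrow> ennreal" where
  "BMO_norm M f = (SUP (x, r)\<in>{(x, r). 0 < r}. mean_osc M f (ball x r))"

definition BMO ::
  "'a::metric_space measure \<Rightarrow> ('a \<Rightarrow> 'b::{real_normed_field, euclidean_space}) set" where
  "BMO M = {f \<in> L1_loc M. BMO_norm M f < \<infinity>}"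

text \<open>Balls are pairs of a center and a radius: one and the same set may be a ball of the
  family \<open>\<D>\<close> for one such pair and not for another.\<close>

definition BMO_rho_norm ::
  "'a::metric_space measure \<Rightarrow> ('a \<Rightarrow> real) \<Rightarrow>
     ('a \<Rightarrow> 'b::{real_normed_field, euclidean_space}) \<Rightarrow> ennreal" where
  "BMO_rho_norm M \<rho> f =
     (SUP (x, r)\<in>{(x, r). 0 < r \<and> r < \<rho> x}. mean_osc M f (ball x r)) +
     (SUP (x, r)\<in>{(x, r). 0 < r \<and> \<rho> x \<le> r}. mean_abs M f (ball x r))"

definition BMO_rho ::
  "'a::metric_space measure \<Rightarrow> ('a \<Rightarrow> real) \<Rightarrow>
     ('a \<Rightarrow> 'b::{real_normed_field, euclidean_space}) set" where
  "BMO_rho M \<rho> = {f \<in> L1_loc M. BMO_rho_norm M \<rho> f < \<infinity>}"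

definition Linf_norm ::
  "'a measure \<Rightarrow> ('a \<Rightarrow> 'b::{real_normed_field, euclidean_space}) \<Rightarrow> ennreal" where
  "Linf_norm M f = esssup M (\<lambda>x. ennreal (norm (f x)))"

definition Linf ::
  "'a measure \<Rightarrow> ('a \<Rightarrow> 'b::{real_normed_field, euclidean_space}) set" where
  "Linf M = {f \<in> borel_measurable M. Linf_norm M f < \<infinity>}"

definition kernel_op ::
  "'a measure \<Rightarrow> ('a \<Rightarrow> 'a \<Rightarrow> real) \<Rightarrow>
     ('a \<Rightarrow> 'b::{real_normed_field, euclidean_space}) \<Rightarrow> 'a \<Rightarrow> 'b" where
  "kernel_op M K f x = (LINT y|M. K x y *\<^sub>R f y)"

end

theory Submission
  imports Defs
begin

text \<open>The kernel operator \<open>f \<mapsto> K f\<close> averages \<open>f\<close> at the critical scale: for fixed \<open>x\<close>, the function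
  \<open>K x\<close> is a probability density that lives on a ball of radius comparable to \<open>\<rho> x\<close> and is bounded
  there by a multiple of the reciprocal measure of that ball.  Moreover, admissibility makes \<open>\<rho>\<close>
  essentially constant on such a ball.  Hence, for \<open>x\<close> near \<open>z\<close> at scale \<open>\<rho> z\<close> and for every
  constant \<open>c\<close>, the difference \<open>K f x - c\<close> is bounded by a multiple of the mean of
  \<open>\<bar>f - c\<bar>\<close> over one ball \<open>ball z (R * \<rho> z)\<close> (lemma \<open>kernel_op_minus_const_le\<close>).  All estimates come from this one.

  With \<open>c = 0\<close> and \<open>z = x\<close> it bounds \<open>K f\<close> uniformly by the norm of \<open>BMO_rho\<close>.  With \<open>c\<close> the average
  of \<open>f\<close> over the ball it says that \<open>K f\<close> deviates from a constant by at most a multiple of the BMO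
  norm on the whole critical ball.  On a smaller ball the oscillation of \<open>K f\<close> is at most twice
  its deviation from that constant, which controls the oscillation of \<open>f - K f\<close> on balls of radius below \<open>\<rho>\<close>, and, since the mean
  deviation of \<open>f\<close> from the same constant is also at most a multiple of its BMO norm, the mean of
  \<open>\<bar>f - K f\<bar>\<close> on balls of radius comparable to \<open>\<rho>\<close>.

  For a larger ball, choose a family of disjoint critical balls centered in it, with as many
  members as possible.  By doubling, such a family is finite, because \<open>\<rho>\<close> is bounded below on bounded sets.  By
  maximality fixed multiples of its members cover the large ball, and by disjointness and doubling
  the measures of these multiples add up to at most a multiple of the measure of the large ball.
  So a bound on the means over balls of critical size passes to all larger balls (lemma
  \<open>mean_abs_supercritical_ball\<close>), which gives (ii).

  For (i), \<open>BMO_rho\<close> embeds into \<open>BMO\<close> since an oscillation is at most twice a mean, and \<open>K b\<close> is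
  bounded by the above.  Conversely, on balls of radius at least \<open>\<rho>\<close> the mean of \<open>\<bar>b\<bar>\<close> is at most
  that of \<open>\<bar>b - K b\<bar>\<close>, controlled by (ii), plus the essential supremum of \<open>\<bar>K b\<bar>\<close>.\<close>

section \<open>Doubling measures\<close>

locale doubling_measure =
  fixes M :: "'a::metric_space measure" and D :: real
  assumes sets_M: "sets M = sets borel"
    and ball_pos: "0 < r \<Longrightarrow> 0 < emeasure M (ball x r)"
    and ball_finite: "0 < r \<Longrightarrow> emeasure M (ball x r) < \<infinity>"
    and D_ge_1: "1 \<le> D"
    and doubling: "0 < r \<Longrightarrow> emeasure M (ball x (2 * r)) \<le> ennreal D * emeasure M (ball x r)"
begin

lemma space_M: "space M = UNIV"
  using sets_eq_imp_space_eq[OF sets_M] by simp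

lemma ball_sets [measurable, simp]: "ball x r \<in> sets M"
  by (simp add: sets_M)

lemma borel_measurable_ball_indicator [measurable]:
  "(indicator (ball x r) :: 'a \<Rightarrow> ennreal) \<in> borel_measurable M"
  by (rule borel_measurable_indicator) simp

lemma emeasure_ball_eq: "0 < r \<Longrightarrow> emeasure M (ball x r) = ennreal (measure M (ball x r))"
  using ball_finite[of r x] by (intro emeasure_eq_ennreal_measure) auto

lemma measure_ball_pos: "0 < r \<Longrightarrow> 0 < measure M (ball x r)"
  using ball_pos[of r x] emeasure_ball_eq[of r x] by (simp add: ennreal_less_zero_iff)

lemma sigma_finite: "sigma_finite_measure M"
proof
  fix x :: 'a
  show "\<exists>A. countable A \<and> A \<subseteq> sets M \<and> \<Union> A = space M \<and> (\<forall>a\<in>A. emeasure M a \<noteq> \<infinity>)"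
  proof (intro exI conjI)
    show "\<Union> (range (\<lambda>n::nat. ball undefined (real (Suc n)))) = space M"
    proof -
      have "y \<in> \<Union> (range (\<lambda>n::nat. ball undefined (real (Suc n))))" for y :: 'a
      proof -
        obtain n :: nat where "dist undefined y < real n"
          using reals_Archimedean2 by blast
        then show ?thesis by (auto intro!: exI[of _ n])
      qed
      then show ?thesis by (auto simp: space_M)
    qed
  qed (use ball_finite in \<open>auto simp: less_top[symmetric] simp del: of_nat_Suc\<close>)
qed

text \<open>Iterating the doubling inequality \<open>n\<close> times dilates by \<open>2 ^ n\<close>; since \<open>t \<le> 2 ^ n\<close> for every \<open>n \<ge> t\<close>, the choice
  \<open>n = \<lceil>t\<rceil>\<close>, cut off at zero, covers the dilation by \<open>t\<close>.\<close>

definition dilation_const :: "real \<Rightarrow> real" where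
  "dilation_const t = D ^ nat \<lceil>t\<rceil>"

lemma dilation_const_nonneg: "0 \<le> dilation_const t"
  unfolding dilation_const_def using D_ge_1 by simp

lemma emeasure_ball_dilation:
  assumes "0 < r"
  shows "emeasure M (ball x (t * r)) \<le> ennreal (dilation_const t) * emeasure M (ball x r)"
proof -
  have pow: "emeasure M (ball x (2 ^ n * r)) \<le> ennreal (D ^ n) * emeasure M (ball x r)" for n
  proof (induction n)
    case (Suc n)
    have "emeasure M (ball x (2 ^ Suc n * r)) = emeasure M (ball x (2 * (2 ^ n * r)))"
      by (simp add: mult.assoc)
    also have "\<dots> \<le> ennreal D * emeasure M (ball x (2 ^ n * r))"
      using assms by (intro doubling) auto
    also have "\<dots> \<le> ennreal D * (ennreal (D ^ n) * emeasure M (ball x r))"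
      by (intro mult_left_mono Suc) auto
    also have "\<dots> = ennreal (D ^ Suc n) * emeasure M (ball x r)"
      using D_ge_1 by (simp add: ennreal_mult mult.assoc)
    finally show ?case .
  qed simp
  have "t \<le> real (nat \<lceil>t\<rceil>)" by linarith
  also have "\<dots> \<le> 2 ^ nat \<lceil>t\<rceil>" by (rule less_imp_le[OF of_nat_less_two_power])
  finally have "ball x (t * r) \<subseteq> ball x (2 ^ nat \<lceil>t\<rceil> * r)"
    using assms by (intro subset_ball mult_right_mono) auto
  then have "emeasure M (ball x (t * r)) \<le> emeasure M (ball x (2 ^ nat \<lceil>t\<rceil> * r))"
    by (intro emeasure_mono) auto
  then show ?thesis using pow[of "nat \<lceil>t\<rceil>"] unfolding dilation_const_def by (rule order_trans)
qed

lemma emeasure_ball_le: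
  assumes "0 < s" "dist x y + r \<le> t * s"
  shows "emeasure M (ball x r) \<le> ennreal (dilation_const t) * emeasure M (ball y s)"
proof -
  have "ball x r \<subseteq> ball y (t * s)"
  proof
    fix w assume "w \<in> ball x r"
    then show "w \<in> ball y (t * s)"
      using assms(2) dist_triangle[of y w x] by (simp add: dist_commute)
  qed
  then have "emeasure M (ball x r) \<le> emeasure M (ball y (t * s))"
    by (intro emeasure_mono) auto
  then show ?thesis using emeasure_ball_dilation[OF assms(1)] by (rule order_trans)
qed

section \<open>Means over balls\<close>

lemma nn_integral_ball_eq_mean_abs:
  assumes "0 < r"
  shows "(\<integral>\<^sup>+y\<in>ball x r. ennreal (norm (f y)) \<partial>M) = mean_abs M f (ball x r) * emeasure M (ball x r)"
proof -
  have "1 / emeasure M (ball x r) * emeasure M (ball x r) = 1"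
    using ball_pos[OF assms, of x] ball_finite[OF assms, of x]
    by (simp add: ennreal_divide_times)
  moreover have "mean_abs M f (ball x r) * emeasure M (ball x r) =
      1 / emeasure M (ball x r) * emeasure M (ball x r) * (\<integral>\<^sup>+y\<in>ball x r. ennreal (norm (f y)) \<partial>M)"
    unfolding mean_abs_def by (simp only: ac_simps)
  ultimately show ?thesis by simp
qed

text \<open>A bound without division, so that means over different balls can be compared by integrals
  and measures alone.\<close>

lemma mean_abs_le_iff:
  assumes "0 < r"
  shows "mean_abs M f (ball x r) \<le> N \<longleftrightarrow>
    (\<integral>\<^sup>+y\<in>ball x r. ennreal (norm (f y)) \<partial>M) \<le> N * emeasure M (ball x r)"
proof
  assume "(\<integral>\<^sup>+y\<in>ball x r. ennreal (norm (f y)) \<partial>M) \<le> N * emeasure M (ball x r)"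
  then show "mean_abs M f (ball x r) \<le> N"
    using divide_le_posI_ennreal[OF ball_pos[OF assms, of x]]
    by (simp add: mean_abs_def ennreal_divide_times mult.commute)
qed (simp add: nn_integral_ball_eq_mean_abs[OF assms] mult_right_mono)

lemma mean_abs_le_bound:
  assumes "0 < r" "\<And>y. y \<in> ball x r \<Longrightarrow> ennreal (norm (f y)) \<le> N"
  shows "mean_abs M f (ball x r) \<le> N"
proof -
  have "(\<integral>\<^sup>+y\<in>ball x r. ennreal (norm (f y)) \<partial>M) \<le> (\<integral>\<^sup>+y\<in>ball x r. N \<partial>M)"
    using assms(2) by (intro nn_integral_mono) (auto simp: indicator_def)
  also have "\<dots> = N * emeasure M (ball x r)" by (simp add: nn_integral_cmult_indicator)
  finally show ?thesis by (simp add: mean_abs_le_iff[OF assms(1)])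
qed

lemma mean_abs_triangle:
  assumes "f \<in> borel_measurable M" "g \<in> borel_measurable M"
    and "\<And>y. norm (h y) \<le> norm (f y) + norm (g y)"
  shows "mean_abs M h (ball x r) \<le> mean_abs M f (ball x r) + mean_abs M g (ball x r)"
proof -
  have "(\<integral>\<^sup>+y\<in>ball x r. ennreal (norm (h y)) \<partial>M) \<le>
      (\<integral>\<^sup>+y. ennreal (norm (f y)) * indicator (ball x r) y + ennreal (norm (g y)) * indicator (ball x r) y \<partial>M)"
    using assms(3)
    by (intro nn_integral_mono) (auto simp: indicator_def ennreal_plus[symmetric] simp del: ennreal_plus)
  also have "\<dots> = (\<integral>\<^sup>+y\<in>ball x r. ennreal (norm (f y)) \<partial>M) + (\<integral>\<^sup>+y\<in>ball x r. ennreal (norm (g y)) \<partial>M)"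
    using assms(1,2) by (intro nn_integral_add borel_measurable_times_ennreal borel_measurable_ball_indicator) auto
  finally show ?thesis
    unfolding mean_abs_def distrib_left[symmetric] by (rule mult_left_mono) simp
qed

lemma L1_locD:
  assumes "f \<in> L1_loc M"
  shows "f \<in> borel_measurable M" "0 < r \<Longrightarrow> set_integrable M (ball x r) f"
  using assms by (auto simp: L1_loc_def)

lemma ennreal_norm_avg_le_mean_abs:
  assumes "0 < r" "set_integrable M (ball x r) f"
  shows "ennreal (norm (avg M f (ball x r))) \<le> mean_abs M f (ball x r)"
proof -
  let ?B = "ball x r"
  have "ennreal (norm (LINT y:?B|M. f y)) \<le> (\<integral>\<^sup>+y. ennreal (norm (indicator ?B y *\<^sub>R f y)) \<partial>M)"
    unfolding set_lebesgue_integral_def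
    using assms(2) by (intro integral_norm_bound_ennreal) (simp add: set_integrable_def)
  also have "\<dots> = (\<integral>\<^sup>+y\<in>?B. ennreal (norm (f y)) \<partial>M)"
    by (intro nn_integral_cong) (auto simp: indicator_def)
  also have "\<dots> = mean_abs M f ?B * emeasure M ?B" by (rule nn_integral_ball_eq_mean_abs[OF assms(1)])
  finally have le: "ennreal (norm (LINT y:?B|M. f y)) \<le> mean_abs M f ?B * emeasure M ?B" .
  have "ennreal (norm (avg M f ?B)) = ennreal (norm (LINT y:?B|M. f y)) / emeasure M ?B"
    using measure_ball_pos[OF assms(1), of x]
    by (simp add: avg_def emeasure_ball_eq[OF assms(1)] divide_ennreal)
  also have "\<dots> \<le> mean_abs M f ?B"
    using le by (intro divide_le_posI_ennreal ball_pos assms(1)) (simp add: mult.commute)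
  finally show ?thesis .
qed

lemma avg_diff_const:
  assumes "0 < r" "set_integrable M (ball x r) f"
  shows "avg M (\<lambda>y. f y - c) (ball x r) = avg M f (ball x r) - c"
    and "set_integrable M (ball x r) (\<lambda>y. f y - c)"
proof -
  have c: "set_integrable M (ball x r) (\<lambda>y. c)"
    using ball_finite[OF assms(1), of x] unfolding set_integrable_def
    by (intro integrable_indicator_iff[THEN iffD2] integrable_scaleR_left) (auto simp: integrable_indicator_iff)
  have "(LINT y:ball x r|M. c) = measure M (ball x r) *\<^sub>R c"
    using ball_finite[OF assms(1), of x] by (simp add: set_lebesgue_integral_def)
  then show "avg M (\<lambda>y. f y - c) (ball x r) = avg M f (ball x r) - c"
    using measure_ball_pos[OF assms(1), of x] assms(2) c
    by (simp add: avg_def set_integral_diff scaleR_diff_right)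
  show "set_integrable M (ball x r) (\<lambda>y. f y - c)"
    using assms(2) c by (rule set_integral_diff)
qed

text \<open>The average is, up to a factor two, the best constant that approximates a function on a
  ball.\<close>

lemma mean_osc_le:
  assumes "0 < r" "f \<in> L1_loc M"
  shows "mean_osc M f (ball x r) \<le> 2 * mean_abs M (\<lambda>y. f y - c) (ball x r)"
proof -
  let ?B = "ball x r" and ?a = "avg M f (ball x r)"
  have meas: "f \<in> borel_measurable M" and int: "set_integrable M ?B f"
    using L1_locD[OF assms(2)] assms(1) by auto
  have "mean_osc M f ?B \<le> mean_abs M (\<lambda>y. f y - c) ?B + mean_abs M (\<lambda>y. ?a - c) ?B"
    unfolding mean_osc_def
  proof (rule mean_abs_triangle)
    show "norm (f y - ?a) \<le> norm (f y - c) + norm (?a - c)" for y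
      using norm_triangle_ineq4[of "f y - c" "?a - c"] by simp
  qed (use meas in measurable)
  also have "mean_abs M (\<lambda>y. ?a - c) ?B \<le> ennreal (norm (?a - c))"
    by (rule mean_abs_le_bound[OF assms(1)]) simp
  also have "\<dots> \<le> mean_abs M (\<lambda>y. f y - c) ?B"
    using ennreal_norm_avg_le_mean_abs[OF assms(1) avg_diff_const(2)[OF assms(1) int, of c]]
    by (simp add: avg_diff_const(1)[OF assms(1) int])
  finally show ?thesis by (simp add: mult_2)
qed

lemma mean_osc_le_BMO_norm: "0 < r \<Longrightarrow> mean_osc M f (ball x r) \<le> BMO_norm M f"
  unfolding BMO_norm_def by (rule SUP_upper2[of "(x, r)"]) auto

lemma mean_abs_subball:
  assumes "0 < s" "s \<le> r"
  shows "mean_abs M f (ball x s) \<le> ennreal (dilation_const (r / s)) * mean_abs M f (ball x r)"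
proof -
  have r: "0 < r" using assms by simp
  have "(\<integral>\<^sup>+y\<in>ball x s. ennreal (norm (f y)) \<partial>M) \<le> (\<integral>\<^sup>+y\<in>ball x r. ennreal (norm (f y)) \<partial>M)"
    using assms(2) by (intro nn_integral_mono) (auto simp: indicator_def)
  also have "\<dots> = mean_abs M f (ball x r) * emeasure M (ball x r)"
    by (rule nn_integral_ball_eq_mean_abs[OF r])
  also have "\<dots> \<le> mean_abs M f (ball x r) * (ennreal (dilation_const (r / s)) * emeasure M (ball x s))"
    using emeasure_ball_dilation[OF assms(1), of x "r / s"] assms(1) by (intro mult_left_mono) auto
  finally show ?thesis by (simp add: mean_abs_le_iff[OF assms(1)] ac_simps)
qed

end

section \<open>Balls of critical radius\<close>

locale critical_radius = doubling_measure M D for M :: "'a::metric_space measure" and D :: real +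
  fixes \<rho> :: "'a \<Rightarrow> real" and C0 k0 :: real
  assumes \<rho>_pos: "0 < \<rho> x"
    and C0_pos: "0 < C0"
    and k0_pos: "0 < k0"
    and admissible: "1 / \<rho> x \<le> C0 * (1 / \<rho> y) * (1 + dist x y / \<rho> y) powr k0"
begin

definition comparison_const :: "real \<Rightarrow> real" where
  "comparison_const t = max 1 (C0 * (1 + t) powr k0)"

lemma comparison_const_ge_1: "1 \<le> comparison_const t"
  by (simp add: comparison_const_def)

text \<open>Admissibility bounds \<open>\<rho> y\<close> by \<open>\<rho> x\<close> in terms of the distance measured in units of \<open>\<rho> y\<close>.  The
  reverse bound follows by exchanging the two points, because the same distance is even smaller in
  units of \<open>\<rho> x\<close> when \<open>\<rho> x\<close> is the larger radius.\<close>

lemma critical_radius_comparable: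
  assumes "dist x y \<le> t * \<rho> y"
  shows "\<rho> y \<le> comparison_const t * \<rho> x" and "\<rho> x \<le> comparison_const t * \<rho> y"
proof -
  have *: "\<rho> v \<le> comparison_const t * \<rho> u" if "dist u v \<le> t * \<rho> v" for u v
  proof -
    have "1 / \<rho> u \<le> C0 * (1 / \<rho> v) * (1 + dist u v / \<rho> v) powr k0" by (rule admissible)
    also have "\<dots> \<le> C0 * (1 / \<rho> v) * (1 + t) powr k0"
    proof (intro mult_left_mono powr_mono2)
      show "1 + dist u v / \<rho> v \<le> 1 + t" using that \<rho>_pos[of v] by (simp add: pos_divide_le_eq)
    qed (use C0_pos k0_pos \<rho>_pos[of v] in auto)
    also have "\<dots> \<le> comparison_const t / \<rho> v"
      using \<rho>_pos[of v] by (simp add: comparison_const_def divide_right_mono)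
    finally show ?thesis using \<rho>_pos[of u] \<rho>_pos[of v] by (simp add: field_simps)
  qed
  show "\<rho> y \<le> comparison_const t * \<rho> x" by (rule *[OF assms])
  show "\<rho> x \<le> comparison_const t * \<rho> y"
  proof (cases "\<rho> y \<le> \<rho> x")
    case True
    have "0 \<le> t" using assms \<rho>_pos[of y] zero_le_dist[of x y]
      by (metis order_trans zero_le_mult_iff linorder_not_less order_less_imp_le)
    then have "t * \<rho> y \<le> t * \<rho> x" using True by (intro mult_left_mono)
    then show ?thesis using assms by (intro *) (simp add: dist_commute)
  next
    case False
    then show ?thesis
      using mult_right_mono[OF comparison_const_ge_1[of t], of "\<rho> y"] \<rho>_pos[of y] by linarith
  qed
qed

text \<open>If two critical balls meet, their centers are less than twice the larger radius apart, so the
  radii differ at most by the factor \<open>comparison_const 2\<close>.  The dilation by \<open>covering_const\<close>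
  therefore swallows the center of any critical ball that meets the given one.\<close>

definition covering_const :: real where
  "covering_const = 1 + comparison_const 2"

lemma critical_balls_meet_imp_mem:
  assumes "ball x (\<rho> x) \<inter> ball z (\<rho> z) \<noteq> {}"
  shows "x \<in> ball z (covering_const * \<rho> z)"
proof -
  obtain w where "dist x w < \<rho> x" "dist z w < \<rho> z" using assms by auto
  then have d: "dist z x < \<rho> x + \<rho> z" using dist_triangle[of z x w] by (simp add: dist_commute)
  have "\<rho> x \<le> comparison_const 2 * \<rho> z"
  proof (cases "\<rho> x \<le> \<rho> z")
    case True
    then show ?thesis using d by (intro critical_radius_comparable(2)) (simp add: dist_commute)
  next
    case False
    then show ?thesis using d by (intro critical_radius_comparable(1)) simp
  qed
  then show ?thesis using d by (simp add: covering_const_def algebra_simps)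
qed

lemma supercritical_ball_contains_critical_balls:
  assumes "\<rho> x \<le> r" "z \<in> ball x r"
  shows "ball z (\<rho> z) \<subseteq> ball x (covering_const * r)"
proof -
  have "0 < r" using assms(1) \<rho>_pos[of x] by simp
  have "\<rho> z \<le> comparison_const 2 * r"
  proof (cases "\<rho> z \<le> r")
    case True
    then show ?thesis using mult_right_mono[OF comparison_const_ge_1[of 2], of r] \<open>0 < r\<close> by linarith
  next
    case False
    have "\<rho> z \<le> comparison_const 2 * \<rho> x"
      using assms(2) False \<open>0 < r\<close> by (intro critical_radius_comparable(1)) simp
    also have "\<dots> \<le> comparison_const 2 * r"
      using assms(1) comparison_const_ge_1[of 2] by (intro mult_left_mono) auto
    finally show ?thesis .
  qed
  then have "r + \<rho> z \<le> covering_const * r" by (simp add: covering_const_def algebra_simps)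
  then have "dist x w < covering_const * r" if "dist z w < \<rho> z" for w
    using that assms(2) dist_triangle[of x w z] by simp
  then show ?thesis by auto
qed

text \<open>On a bounded set \<open>\<rho>\<close> is bounded below by a multiple of \<open>\<rho> x\<close>, so each critical ball centered there
  carries a fixed fraction of the measure of \<open>ball x r\<close>; all of them lie in a dilate of this ball,
  so only boundedly many can be disjoint.\<close>

lemma critical_ball_family_bounded:
  assumes "\<rho> x \<le> r"
  shows "\<exists>N::nat. \<forall>Z. finite Z \<and> Z \<subseteq> ball x r \<and> disjoint_family_on (\<lambda>z. ball z (\<rho> z)) Z \<longrightarrow> card Z \<le> N"
proof -
  have r: "0 < r" using assms \<rho>_pos[of x] by simp
  define L where "L = comparison_const (r / \<rho> x)"
  define P where "P = dilation_const (2 * r * L / \<rho> x)"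
  define Q where "Q = dilation_const covering_const"
  have PQ: "0 \<le> P" "0 \<le> Q"
    unfolding P_def Q_def by (rule dilation_const_nonneg)+
  have large: "emeasure M (ball x r) \<le> ennreal P * emeasure M (ball z (\<rho> z))" if "z \<in> ball x r" for z
    unfolding P_def
  proof (rule emeasure_ball_le[OF \<rho>_pos])
    have "\<rho> x \<le> L * \<rho> z"
      unfolding L_def using that \<rho>_pos[of x]
      by (intro critical_radius_comparable(1)) (simp add: dist_commute)
    then have "2 * r * \<rho> x \<le> 2 * r * (L * \<rho> z)" using r by (intro mult_left_mono) auto
    then have "2 * r \<le> 2 * r * L / \<rho> x * \<rho> z" using \<rho>_pos[of x] by (simp add: field_simps)
    then show "dist x z + r \<le> 2 * r * L / \<rho> x * \<rho> z" using that by simp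
  qed
  have "real (card Z) \<le> P * Q"
    if Z: "finite Z" "Z \<subseteq> ball x r" "disjoint_family_on (\<lambda>z. ball z (\<rho> z)) Z" for Z
  proof -
    have "of_nat (card Z) * emeasure M (ball x r) = (\<Sum>z\<in>Z. emeasure M (ball x r))" by simp
    also have "\<dots> \<le> (\<Sum>z\<in>Z. ennreal P * emeasure M (ball z (\<rho> z)))"
      using Z(2) by (intro sum_mono large) auto
    also have "\<dots> = ennreal P * emeasure M (\<Union>z\<in>Z. ball z (\<rho> z))"
      using Z by (subst sum_emeasure[symmetric]) (auto simp: sum_distrib_left)
    also have "\<dots> \<le> ennreal P * emeasure M (ball x (covering_const * r))"
      using Z(2) supercritical_ball_contains_critical_balls[OF assms]
      by (intro mult_left_mono emeasure_mono UN_least ball_sets zero_le) blast+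
    also have "\<dots> \<le> ennreal P * (ennreal Q * emeasure M (ball x r))"
      unfolding Q_def by (intro mult_left_mono emeasure_ball_dilation r) auto
    finally have "ennreal (real (card Z) * measure M (ball x r)) \<le> ennreal (P * Q * measure M (ball x r))"
      using PQ by (simp add: emeasure_ball_eq[OF r] ennreal_mult ennreal_of_nat_eq_real_of_nat mult.assoc)
    then show ?thesis
      using PQ measure_ball_pos[OF r, of x] by (simp add: ennreal_le_iff)
  qed
  then show ?thesis by (intro exI[of _ "nat \<lfloor>P * Q\<rfloor>"]) (auto simp: le_nat_floor)
qed

text \<open>A Vitali-type covering: in a disjoint family of the largest possible cardinality every other
  critical ball centered in \<open>ball x r\<close> meets a member, so that the dilated members cover.  The dilated
  balls may overlap heavily; what will be summed are the measures of the disjoint ones.\<close>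

lemma critical_ball_covering:
  assumes "\<rho> x \<le> r"
  obtains Z where "finite Z" "Z \<subseteq> ball x r" "disjoint_family_on (\<lambda>z. ball z (\<rho> z)) Z"
    "ball x r \<subseteq> (\<Union>z\<in>Z. ball z (covering_const * \<rho> z))"
proof -
  define P where "P Z \<longleftrightarrow> finite Z \<and> Z \<subseteq> ball x r \<and> disjoint_family_on (\<lambda>z. ball z (\<rho> z)) Z" for Z
  obtain N :: nat where N: "\<forall>Z. P Z \<longrightarrow> card Z \<le> N"
    using critical_ball_family_bounded[OF assms] unfolding P_def by (rule exE)
  have "P {}" by (simp add: P_def disjoint_family_on_def)
  moreover have "\<forall>Z. P Z \<longrightarrow> card Z < Suc N" using N by (simp add: less_Suc_eq_le)
  ultimately obtain Z where PZ: "P Z" and max: "\<forall>Y. P Y \<longrightarrow> card Y \<le> card Z"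
    using ex_has_greatest_nat[of P "{}" card "Suc N"] by metis
  from PZ have Z: "finite Z" "Z \<subseteq> ball x r" "disjoint_family_on (\<lambda>z. ball z (\<rho> z)) Z"
    by (simp_all add: P_def)
  have "w \<in> (\<Union>z\<in>Z. ball z (covering_const * \<rho> z))" if w: "w \<in> ball x r" for w
  proof (cases "\<exists>z\<in>Z. ball w (\<rho> w) \<inter> ball z (\<rho> z) \<noteq> {}")
    case True
    then show ?thesis using critical_balls_meet_imp_mem by blast
  next
    case False
    have "w \<notin> Z"
    proof
      assume "w \<in> Z"
      then have "ball w (\<rho> w) = {}" using False by blast
      then show False using \<rho>_pos[of w] by (simp add: ball_eq_empty)
    qed
    moreover have "disjoint_family_on (\<lambda>z. ball z (\<rho> z)) (insert w Z)"
      using Z(3) False \<open>w \<notin> Z\<close> by (subst disjoint_family_on_insert) blast+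
    then have "P (insert w Z)" using Z(1,2) w by (simp add: P_def)
    ultimately have False using max[rule_format, of "insert w Z"] Z(1) by simp
    then show ?thesis ..
  qed
  then show thesis using that[OF Z] by blast
qed

text \<open>Sum the integrals over the dilated balls of the covering, return to the disjoint critical
  balls by doubling, and compare the measure of their union with that of \<open>ball x r\<close>: each of the
  two comparisons of measures costs one factor \<open>dilation_const covering_const\<close>.\<close>

lemma mean_abs_supercritical_ball:
  assumes meas: "g \<in> borel_measurable M"
    and N: "\<And>z. mean_abs M g (ball z (covering_const * \<rho> z)) \<le> N"
    and r: "\<rho> x \<le> r"
  shows "mean_abs M g (ball x r) \<le> ennreal (dilation_const covering_const ^ 2) * N"
proof -
  let ?I = "\<lambda>B. \<integral>\<^sup>+y\<in>B. ennreal (norm (g y)) \<partial>M"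
  let ?q = "ennreal (dilation_const covering_const)"
  have r0: "0 < r" using r \<rho>_pos[of x] by simp
  have cov: "0 < covering_const" using comparison_const_ge_1[of 2] by (simp add: covering_const_def)
  obtain Z where Z: "finite Z" "Z \<subseteq> ball x r" "disjoint_family_on (\<lambda>z. ball z (\<rho> z)) Z"
    "ball x r \<subseteq> (\<Union>z\<in>Z. ball z (covering_const * \<rho> z))"
    using critical_ball_covering[OF r] by blast
  have "?I (ball x r) \<le>
      (\<integral>\<^sup>+y. (\<Sum>z\<in>Z. ennreal (norm (g y)) * indicator (ball z (covering_const * \<rho> z)) y) \<partial>M)"
  proof (rule nn_integral_mono)
    fix y
    show "ennreal (norm (g y)) * indicator (ball x r) y
        \<le> (\<Sum>z\<in>Z. ennreal (norm (g y)) * indicator (ball z (covering_const * \<rho> z)) y)"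
    proof (cases "y \<in> ball x r")
      case True
      then obtain z where z: "z \<in> Z" "y \<in> ball z (covering_const * \<rho> z)" using Z(4) by blast
      have "ennreal (norm (g y)) * indicator (ball x r) y
          \<le> ennreal (norm (g y)) * indicator (ball z (covering_const * \<rho> z)) y"
        using True z(2) by simp
      also have "\<dots> \<le> (\<Sum>z\<in>Z. ennreal (norm (g y)) * indicator (ball z (covering_const * \<rho> z)) y)"
        using z(1) Z(1) by (intro member_le_sum) auto
      finally show ?thesis .
    qed simp
  qed
  also have "\<dots> = (\<Sum>z\<in>Z. ?I (ball z (covering_const * \<rho> z)))"
    using meas by (intro nn_integral_sum borel_measurable_times_ennreal borel_measurable_ball_indicator) auto
  also have "\<dots> \<le> (\<Sum>z\<in>Z. N * (?q * emeasure M (ball z (\<rho> z))))"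
  proof (rule sum_mono)
    fix z
    have "?I (ball z (covering_const * \<rho> z)) \<le> N * emeasure M (ball z (covering_const * \<rho> z))"
      using N[of z] cov \<rho>_pos[of z] by (simp add: mean_abs_le_iff)
    also have "\<dots> \<le> N * (?q * emeasure M (ball z (\<rho> z)))"
      by (intro mult_left_mono emeasure_ball_dilation \<rho>_pos) auto
    finally show "?I (ball z (covering_const * \<rho> z)) \<le> N * (?q * emeasure M (ball z (\<rho> z)))" .
  qed
  also have "\<dots> = N * (?q * emeasure M (\<Union>z\<in>Z. ball z (\<rho> z)))"
    using Z by (subst sum_emeasure[symmetric]) (auto simp: sum_distrib_left)
  also have "\<dots> \<le> N * (?q * emeasure M (ball x (covering_const * r)))"
    using Z(2) supercritical_ball_contains_critical_balls[OF r]
    by (intro mult_left_mono emeasure_mono UN_least ball_sets zero_le) blast+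
  also have "\<dots> \<le> N * (?q * (?q * emeasure M (ball x r)))"
    by (intro mult_left_mono emeasure_ball_dilation r0) auto
  also have "\<dots> = ennreal (dilation_const covering_const ^ 2) * N * emeasure M (ball x r)"
    by (simp add: dilation_const_nonneg power2_eq_square ennreal_mult ac_simps)
  finally show ?thesis by (simp add: mean_abs_le_iff[OF r0])
qed

text \<open>Every ball lies in a concentric one of radius at least \<open>\<rho>\<close>, so finite means over these suffice.\<close>

lemma L1_locI:
  assumes meas: "g \<in> borel_measurable M"
    and fin: "\<And>x r. \<rho> x \<le> r \<Longrightarrow> mean_abs M g (ball x r) < \<infinity>"
  shows "g \<in> L1_loc M"
  unfolding L1_loc_def
proof (intro CollectI conjI allI impI meas)
  fix x and r :: real assume "0 < r"
  define s where "s = max r (\<rho> x)"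
  have s: "0 < s" "\<rho> x \<le> s" "r \<le> s" using \<open>0 < r\<close> by (auto simp: s_def)
  have "(\<integral>\<^sup>+y. ennreal (norm (indicator (ball x s) y *\<^sub>R g y)) \<partial>M) = (\<integral>\<^sup>+y\<in>ball x s. ennreal (norm (g y)) \<partial>M)"
    by (intro nn_integral_cong) (auto simp: indicator_def)
  also have "\<dots> < \<infinity>"
    using fin[OF s(2)] ball_finite[OF s(1), of x]
    by (simp add: nn_integral_ball_eq_mean_abs[OF s(1)] ennreal_mult_less_top)
  finally have "set_integrable M (ball x s) g"
    unfolding set_integrable_def using meas
    by (intro integrableI_bounded borel_measurable_scaleR borel_measurable_indicator) auto
  then show "set_integrable M (ball x r) g"
    by (rule set_integrable_subset) (use s(3) in auto)
qed

lemma BMO_rho_norm_le: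
  assumes "\<And>x r. 0 < r \<Longrightarrow> r < \<rho> x \<Longrightarrow> mean_osc M f (ball x r) \<le> a"
    and "\<And>x r. \<rho> x \<le> r \<Longrightarrow> mean_abs M f (ball x r) \<le> b"
  shows "BMO_rho_norm M \<rho> f \<le> a + b"
  unfolding BMO_rho_norm_def using assms by (intro add_mono SUP_least) auto

lemma subcritical_mean_osc_le:
  "0 < r \<Longrightarrow> r < \<rho> x \<Longrightarrow> mean_osc M f (ball x r) \<le> BMO_rho_norm M \<rho> f"
  unfolding BMO_rho_norm_def by (intro add_increasing2[OF zero_le] SUP_upper2[of "(x, r)"]) auto

lemma supercritical_mean_abs_le:
  "\<rho> x \<le> r \<Longrightarrow> mean_abs M f (ball x r) \<le> BMO_rho_norm M \<rho> f"
  unfolding BMO_rho_norm_def using \<rho>_pos[of x]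
  by (intro add_increasing[OF zero_le] SUP_upper2[of "(x, r)"]) auto

lemma BMO_norm_le_BMO_rho_norm:
  assumes "f \<in> L1_loc M"
  shows "BMO_norm M f \<le> 2 * BMO_rho_norm M \<rho> f"
  unfolding BMO_norm_def
proof (rule SUP_least, clarify)
  fix x and r :: real assume r: "0 < r"
  show "mean_osc M f (ball x r) \<le> 2 * BMO_rho_norm M \<rho> f"
  proof (cases "r < \<rho> x")
    case True
    have "BMO_rho_norm M \<rho> f \<le> 2 * BMO_rho_norm M \<rho> f" by (simp add: mult_2)
    then show ?thesis using subcritical_mean_osc_le[OF r True] by (rule order_trans[rotated])
  next
    case False
    have "mean_osc M f (ball x r) \<le> 2 * mean_abs M (\<lambda>y. f y - 0) (ball x r)"
      by (rule mean_osc_le[OF r assms])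
    also have "\<dots> \<le> 2 * BMO_rho_norm M \<rho> f"
      using False supercritical_mean_abs_le[of x r f] by (intro mult_left_mono) auto
    finally show ?thesis .
  qed
qed

end

section \<open>Averaging kernels at the critical scale\<close>

locale critical_kernel = critical_radius M D \<rho> C0 k0
  for M :: "'a::metric_space measure" and D :: real and \<rho> :: "'a \<Rightarrow> real" and C0 k0 :: real +
  fixes K :: "'a \<Rightarrow> 'a \<Rightarrow> real" and C5 :: real
  assumes K_meas: "case_prod K \<in> borel_measurable (M \<Otimes>\<^sub>M M)"
    and K_nonneg: "0 \<le> K x y"
    and C5_pos: "0 < C5"
    and K_support: "dist x y > C5 * min (\<rho> x) (\<rho> y) \<Longrightarrow> K x y = 0"
    and K_bound: "K x y \<le> C5 * (1 / (measure M (ball x (\<rho> x)) + measure M (ball y (\<rho> y))))"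
    and K_sym: "K x y = K y x"
    and K_mass: "(LINT x|M. K x y) = 1"
begin

lemma K_section_meas: "K x \<in> borel_measurable M"
proof -
  have "(\<lambda>y. case_prod K (x, y)) \<in> borel_measurable M"
    using K_meas by (rule measurable_Pair2) (simp add: space_M)
  then show ?thesis by simp
qed

lemma K_section_mass: "(LINT y|M. K x y) = 1"
proof -
  have "(\<lambda>y. K y x) = K x" by (rule ext) (rule K_sym)
  then show ?thesis using K_mass[of x] by simp
qed

lemma K_section_integrable: "integrable M (K x)"
  using K_section_mass[of x] not_integrable_integral_eq[of M "K x"] by auto

lemma K_le: "K x y \<le> C5 / measure M (ball x (\<rho> x))"
proof -
  have "C5 * (1 / (measure M (ball x (\<rho> x)) + measure M (ball y (\<rho> y)))) \<le> C5 / measure M (ball x (\<rho> x))"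
    using C5_pos measure_ball_pos[OF \<rho>_pos, of x x] by (simp add: divide_left_mono frac_le)
  then show ?thesis using K_bound[of x y] by (rule order_trans[rotated])
qed

lemma kernel_op_meas:
  fixes f :: "'a \<Rightarrow> 'b::{real_normed_field, euclidean_space}"
  assumes "f \<in> borel_measurable M"
  shows "kernel_op M K f \<in> borel_measurable M"
proof -
  interpret sigma_finite_measure M by (rule sigma_finite)
  note [measurable] = K_meas assms
  have "(\<lambda>x. LINT y|M. K x y *\<^sub>R f y) \<in> borel_measurable M"
    by (rule borel_measurable_lebesgue_integral) measurable
  then show ?thesis by (simp add: kernel_op_def[abs_def])
qed

text \<open>Since \<open>K x\<close> has mass one, \<open>K f x - c\<close> is the integral of \<open>K x y *\<^sub>R (f y - c)\<close>.  The support of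
  \<open>K x\<close> lies within \<open>C5 * \<rho> x\<close> of \<open>x\<close>, hence in \<open>ball z (R * \<rho> z)\<close> by comparability of \<open>\<rho> x\<close> with
  \<open>\<rho> z\<close>, and the bound on \<open>K x\<close> by the reciprocal measure of \<open>ball x (\<rho> x)\<close> becomes, by doubling, one
  by the reciprocal measure of this larger ball.\<close>

lemma kernel_op_minus_const_le:
  fixes t :: real
  assumes "0 \<le> t"
  shows "\<exists>R C. t \<le> R \<and> 1 \<le> R \<and> 0 \<le> C \<and>
    (\<forall>f c z x. f \<in> (L1_loc M :: ('a \<Rightarrow> 'b::{real_normed_field, euclidean_space}) set) \<longrightarrow>
      x \<in> ball z (t * \<rho> z) \<longrightarrow>
      ennreal (norm (kernel_op M K f x - c)) \<le> ennreal C * mean_abs M (\<lambda>y. f y - c) (ball z (R * \<rho> z)))"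
proof -
  define L where "L = comparison_const t"
  define R where "R = t + C5 * L + 1"
  define q where "q = dilation_const ((t + R) * L)"
  have L: "1 \<le> L" unfolding L_def by (rule comparison_const_ge_1)
  have q: "0 \<le> q" unfolding q_def by (rule dilation_const_nonneg)
  have CL: "0 < C5 * L" using L C5_pos by simp
  have R: "t \<le> R" "1 \<le> R" using CL assms by (auto simp: R_def)
  have "ennreal (norm (kernel_op M K f x - c)) \<le> ennreal (C5 * q) * mean_abs M (\<lambda>y. f y - c) (ball z (R * \<rho> z))"
    if f: "f \<in> L1_loc M" and x: "x \<in> ball z (t * \<rho> z)" for f :: "'a \<Rightarrow> 'b" and c z x
  proof -
    let ?B = "ball z (R * \<rho> z)"
    define k where "k = C5 / measure M (ball x (\<rho> x))"
    have k: "0 \<le> k" "k * measure M (ball x (\<rho> x)) = C5"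
      using measure_ball_pos[OF \<rho>_pos, of x x] C5_pos by (auto simp: k_def)
    have R0: "0 < R * \<rho> z" using R(2) \<rho>_pos[of z] by simp
    have comp: "\<rho> x \<le> L * \<rho> z" "\<rho> z \<le> L * \<rho> x"
      unfolding L_def using critical_radius_comparable[of x z t] x by (auto simp: dist_commute)
    have K_le_k: "K x y \<le> k * indicator ?B y" for y
    proof (cases "y \<in> ?B")
      case True
      then show ?thesis using K_le[of x y] by (simp add: k_def)
    next
      case False
      have "C5 * min (\<rho> x) (\<rho> y) \<le> C5 * (L * \<rho> z)"
        using comp(1) C5_pos by (intro mult_left_mono) auto
      moreover have "R * \<rho> z = t * \<rho> z + C5 * (L * \<rho> z) + \<rho> z" by (simp add: R_def algebra_simps)
      ultimately have "C5 * min (\<rho> x) (\<rho> y) < dist x y"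
        using False x dist_triangle[of z y x] \<rho>_pos[of z] by simp
      then show ?thesis using K_support[of x y] False by simp
    qed
    have fm: "f \<in> borel_measurable M" and fi: "set_integrable M ?B f" using L1_locD[OF f] R0 by auto
    have int_f: "integrable M (\<lambda>y. K x y *\<^sub>R f y)"
    proof (rule Bochner_Integration.integrable_bound)
      show "integrable M (\<lambda>y. k *\<^sub>R (indicator ?B y *\<^sub>R f y))"
        using fi unfolding set_integrable_def by (rule integrable_scaleR_right)
      show "(\<lambda>y. K x y *\<^sub>R f y) \<in> borel_measurable M"
        using K_section_meas fm by (rule borel_measurable_scaleR)
      show "AE y in M. norm (K x y *\<^sub>R f y) \<le> norm (k *\<^sub>R (indicator ?B y *\<^sub>R f y))"
      proof (rule AE_I2)
        fix y
        show "norm (K x y *\<^sub>R f y) \<le> norm (k *\<^sub>R (indicator ?B y *\<^sub>R f y))"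
          using mult_right_mono[OF K_le_k[of y], of "norm (f y)"] K_nonneg[of x y] k(1)
          by (simp add: mult.assoc)
      qed
    qed
    have int_c: "integrable M (\<lambda>y. K x y *\<^sub>R c)"
      using K_section_integrable by (rule integrable_scaleR_left)
    have "(LINT y|M. K x y *\<^sub>R c) = c"
      using K_section_mass[of x] K_section_integrable[of x] by (simp add: integral_scaleR_left)
    then have "kernel_op M K f x - c = (LINT y|M. K x y *\<^sub>R (f y - c))"
      using int_f int_c by (simp add: kernel_op_def scaleR_diff_right)
    moreover have "integrable M (\<lambda>y. K x y *\<^sub>R (f y - c))"
      using int_f int_c by (simp add: scaleR_diff_right)
    ultimately have "ennreal (norm (kernel_op M K f x - c)) \<le> (\<integral>\<^sup>+y. ennreal (norm (K x y *\<^sub>R (f y - c))) \<partial>M)"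
      by (simp only: integral_norm_bound_ennreal)
    also have "\<dots> \<le> (\<integral>\<^sup>+y. ennreal k * (ennreal (norm (f y - c)) * indicator ?B y) \<partial>M)"
    proof (rule nn_integral_mono)
      fix y
      have "norm (K x y *\<^sub>R (f y - c)) \<le> k * (norm (f y - c) * indicator ?B y)"
        using mult_right_mono[OF K_le_k[of y], of "norm (f y - c)"] K_nonneg[of x y]
        by (simp add: ac_simps)
      then have "ennreal (norm (K x y *\<^sub>R (f y - c))) \<le> ennreal (k * (norm (f y - c) * indicator ?B y))"
        by (rule ennreal_leI)
      also have "\<dots> = ennreal k * (ennreal (norm (f y - c)) * indicator ?B y)"
        using k(1) by (auto simp: ennreal_mult indicator_def)
      finally show "ennreal (norm (K x y *\<^sub>R (f y - c))) \<le> ennreal k * (ennreal (norm (f y - c)) * indicator ?B y)" .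
    qed
    also have "\<dots> = ennreal k * (\<integral>\<^sup>+y\<in>?B. ennreal (norm (f y - c)) \<partial>M)"
      using fm by (intro nn_integral_cmult borel_measurable_times_ennreal borel_measurable_ball_indicator) auto
    also have "\<dots> = ennreal k * (mean_abs M (\<lambda>y. f y - c) ?B * emeasure M ?B)"
      by (simp add: nn_integral_ball_eq_mean_abs[OF R0])
    also have "\<dots> \<le> ennreal k * (mean_abs M (\<lambda>y. f y - c) ?B * (ennreal q * emeasure M (ball x (\<rho> x))))"
      unfolding q_def
    proof (intro mult_left_mono emeasure_ball_le \<rho>_pos)
      have "(t + R) * \<rho> z \<le> (t + R) * (L * \<rho> x)"
        using comp(2) R assms by (intro mult_left_mono) auto
      then show "dist z x + R * \<rho> z \<le> (t + R) * L * \<rho> x" using x by (simp add: algebra_simps)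
    qed auto
    also have "\<dots> = ennreal (k * measure M (ball x (\<rho> x))) * ennreal q * mean_abs M (\<lambda>y. f y - c) ?B"
      using k(1) q by (simp add: emeasure_ball_eq[OF \<rho>_pos] ennreal_mult ac_simps)
    also have "\<dots> = ennreal (C5 * q) * mean_abs M (\<lambda>y. f y - c) ?B"
      using k(2) q C5_pos by (simp add: ennreal_mult)
    finally show ?thesis .
  qed
  moreover have "0 \<le> C5 * q" using q C5_pos by simp
  ultimately show ?thesis using R by blast
qed

text \<open>The case \<open>c = 0\<close> and \<open>z = x\<close>: the mean on the right is over a ball of radius at least \<open>\<rho> x\<close>.\<close>

lemma kernel_op_Linf_norm_le:
  "\<exists>C\<ge>0. \<forall>f \<in> (L1_loc M :: ('a \<Rightarrow> 'b::{real_normed_field, euclidean_space}) set).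
     Linf_norm M (kernel_op M K f) \<le> ennreal C * BMO_rho_norm M \<rho> f"
proof -
  obtain R C where R: "1 \<le> R" and C: "0 \<le> C"
    and le: "\<And>f c z x. f \<in> (L1_loc M :: ('a \<Rightarrow> 'b) set) \<Longrightarrow> x \<in> ball z (1 * \<rho> z) \<Longrightarrow>
      ennreal (norm (kernel_op M K f x - c)) \<le> ennreal C * mean_abs M (\<lambda>y. f y - c) (ball z (R * \<rho> z))"
    using kernel_op_minus_const_le[of 1, where 'b='b] by auto
  have "Linf_norm M (kernel_op M K f) \<le> ennreal C * BMO_rho_norm M \<rho> f"
    if f: "f \<in> L1_loc M" for f :: "'a \<Rightarrow> 'b"
    unfolding Linf_norm_def
  proof (rule esssup_I)
    show "(\<lambda>x. ennreal (norm (kernel_op M K f x))) \<in> borel_measurable M"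
      using kernel_op_meas[OF L1_locD(1)[OF f]] by measurable
    have "ennreal (norm (kernel_op M K f x)) \<le> ennreal C * BMO_rho_norm M \<rho> f" for x
    proof -
      have "ennreal (norm (kernel_op M K f x)) \<le> ennreal C * mean_abs M f (ball x (R * \<rho> x))"
        using le[OF f, of x x 0] \<rho>_pos[of x] by simp
      also have "\<dots> \<le> ennreal C * BMO_rho_norm M \<rho> f"
        using mult_right_mono[OF R, of "\<rho> x"] \<rho>_pos[of x]
        by (intro mult_left_mono supercritical_mean_abs_le) auto
      finally show ?thesis .
    qed
    then show "AE x in M. ennreal (norm (kernel_op M K f x)) \<le> ennreal C * BMO_rho_norm M \<rho> f" by simp
  qed
  then show ?thesis using C by blast
qed

text \<open>The case where \<open>c\<close> is the average of \<open>f\<close>: the mean of \<open>\<bar>f - c\<bar>\<close> is then an oscillation of \<open>f\<close>.\<close>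

lemma kernel_op_near_avg:
  fixes t :: real
  assumes "0 \<le> t"
  shows "\<exists>R C. t \<le> R \<and> 1 \<le> R \<and> 0 \<le> C \<and>
    (\<forall>f z x. f \<in> (L1_loc M :: ('a \<Rightarrow> 'b::{real_normed_field, euclidean_space}) set) \<longrightarrow>
      x \<in> ball z (t * \<rho> z) \<longrightarrow>
      ennreal (norm (kernel_op M K f x - avg M f (ball z (R * \<rho> z)))) \<le> ennreal C * BMO_norm M f)"
proof -
  obtain R C where R: "t \<le> R" "1 \<le> R" and C: "0 \<le> C"
    and le: "\<And>f c z x. f \<in> (L1_loc M :: ('a \<Rightarrow> 'b) set) \<Longrightarrow> x \<in> ball z (t * \<rho> z) \<Longrightarrow>
      ennreal (norm (kernel_op M K f x - c)) \<le> ennreal C * mean_abs M (\<lambda>y. f y - c) (ball z (R * \<rho> z))"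
    using kernel_op_minus_const_le[OF assms, where 'b='b] by auto
  have "ennreal (norm (kernel_op M K f x - avg M f (ball z (R * \<rho> z)))) \<le> ennreal C * BMO_norm M f"
    if "f \<in> L1_loc M" "x \<in> ball z (t * \<rho> z)" for f :: "'a \<Rightarrow> 'b" and z x
  proof -
    have "ennreal (norm (kernel_op M K f x - avg M f (ball z (R * \<rho> z))))
        \<le> ennreal C * mean_osc M f (ball z (R * \<rho> z))"
      unfolding mean_osc_def by (rule le[OF that])
    also have "\<dots> \<le> ennreal C * BMO_norm M f"
      using R(2) \<rho>_pos[of z] by (intro mult_left_mono mean_osc_le_BMO_norm) auto
    finally show ?thesis .
  qed
  then show ?thesis using R C by blast
qed

text \<open>On \<open>ball z (covering_const * \<rho> z)\<close> both \<open>f\<close>, in the mean, and \<open>K f\<close>, pointwise, are close to one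
  and the same average of \<open>f\<close>.  The covering argument passes from these balls to larger ones.\<close>

lemma diff_kernel_op_supercritical:
  "\<exists>C\<ge>0. \<forall>f x r. f \<in> (L1_loc M :: ('a \<Rightarrow> 'b::{real_normed_field, euclidean_space}) set) \<longrightarrow> \<rho> x \<le> r \<longrightarrow>
     mean_abs M (\<lambda>y. f y - kernel_op M K f y) (ball x r) \<le> ennreal C * BMO_norm M f"
proof -
  have cov: "1 \<le> covering_const" using comparison_const_ge_1[of 2] by (simp add: covering_const_def)
  then obtain R C where R: "covering_const \<le> R" "1 \<le> R" and C: "0 \<le> C"
    and near: "\<And>f z x. f \<in> (L1_loc M :: ('a \<Rightarrow> 'b) set) \<Longrightarrow> x \<in> ball z (covering_const * \<rho> z) \<Longrightarrow>
      ennreal (norm (kernel_op M K f x - avg M f (ball z (R * \<rho> z)))) \<le> ennreal C * BMO_norm M f"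
    using kernel_op_near_avg[of covering_const, where 'b='b] by auto
  define q where "q = dilation_const (R / covering_const)"
  have q: "0 \<le> q" unfolding q_def by (rule dilation_const_nonneg)
  have "mean_abs M (\<lambda>y. f y - kernel_op M K f y) (ball x r)
      \<le> ennreal (dilation_const covering_const ^ 2 * (q + C)) * BMO_norm M f"
    if f: "f \<in> L1_loc M" and r: "\<rho> x \<le> r" for f :: "'a \<Rightarrow> 'b" and x r
  proof -
    note meas = L1_locD(1)[OF f] kernel_op_meas[OF L1_locD(1)[OF f]]
    have "mean_abs M (\<lambda>y. f y - kernel_op M K f y) (ball z (covering_const * \<rho> z))
        \<le> ennreal (q + C) * BMO_norm M f" for z
    proof -
      let ?a = "avg M f (ball z (R * \<rho> z))" and ?S = "ball z (covering_const * \<rho> z)"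
      have pos: "0 < covering_const * \<rho> z" "0 < R * \<rho> z" using cov R(2) \<rho>_pos[of z] by auto
      have "mean_abs M (\<lambda>y. f y - kernel_op M K f y) ?S
          \<le> mean_abs M (\<lambda>y. f y - ?a) ?S + mean_abs M (\<lambda>y. kernel_op M K f y - ?a) ?S"
      proof (rule mean_abs_triangle)
        show "norm (f y - kernel_op M K f y) \<le> norm (f y - ?a) + norm (kernel_op M K f y - ?a)" for y
          using norm_triangle_ineq4[of "f y - ?a" "kernel_op M K f y - ?a"] by simp
      qed (use meas in measurable)
      also have "mean_abs M (\<lambda>y. f y - ?a) ?S \<le> ennreal q * BMO_norm M f"
      proof -
        have "R * \<rho> z / (covering_const * \<rho> z) = R / covering_const" using \<rho>_pos[of z] by simp
        then have "mean_abs M (\<lambda>y. f y - ?a) ?S \<le> ennreal q * mean_osc M f (ball z (R * \<rho> z))"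
          using mean_abs_subball[of "covering_const * \<rho> z" "R * \<rho> z" "\<lambda>y. f y - ?a" z]
            pos R(1) \<rho>_pos[of z]
          by (simp add: q_def mean_osc_def)
        also have "\<dots> \<le> ennreal q * BMO_norm M f"
          by (intro mult_left_mono mean_osc_le_BMO_norm pos) simp
        finally show ?thesis .
      qed
      also have "mean_abs M (\<lambda>y. kernel_op M K f y - ?a) ?S \<le> ennreal C * BMO_norm M f"
        using near[OF f] by (rule mean_abs_le_bound[OF pos(1)])
      finally show ?thesis using q C by (simp add: distrib_right ennreal_plus add_mono)
    qed
    then have "mean_abs M (\<lambda>y. f y - kernel_op M K f y) (ball x r)
        \<le> ennreal (dilation_const covering_const ^ 2) * (ennreal (q + C) * BMO_norm M f)"
      using meas by (intro mean_abs_supercritical_ball r) auto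
    also have "\<dots> = ennreal (dilation_const covering_const ^ 2 * (q + C)) * BMO_norm M f"
      using q C by (simp add: ennreal_mult mult.assoc)
    finally show ?thesis .
  qed
  moreover have "0 \<le> dilation_const covering_const ^ 2 * (q + C)" using q C by simp
  ultimately show ?thesis by blast
qed

lemma diff_kernel_op_L1_loc:
  assumes "f \<in> BMO M"
  shows "(\<lambda>x. f x - kernel_op M K f x) \<in> L1_loc M"
proof (rule L1_locI)
  have f: "f \<in> L1_loc M" "BMO_norm M f < \<infinity>" using assms by (auto simp: BMO_def)
  show "(\<lambda>x. f x - kernel_op M K f x) \<in> borel_measurable M"
    using L1_locD(1)[OF f(1)] kernel_op_meas[OF L1_locD(1)[OF f(1)]] by measurable
  fix x r assume "\<rho> x \<le> r"
  then obtain C where "mean_abs M (\<lambda>x. f x - kernel_op M K f x) (ball x r) \<le> ennreal C * BMO_norm M f"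
    using diff_kernel_op_supercritical f(1) by blast
  also have "\<dots> < \<infinity>" using f(2) by (simp add: ennreal_mult_less_top)
  finally show "mean_abs M (\<lambda>x. f x - kernel_op M K f x) (ball x r) < \<infinity>" .
qed

text \<open>On a small ball \<open>f\<close> is compared with its average over that ball, but \<open>K f\<close> with the average of
  \<open>f\<close> over a ball of critical size.  The two averages may be far apart, but an oscillation ignores
  constants.\<close>

lemma diff_kernel_op_subcritical:
  "\<exists>C\<ge>0. \<forall>f x r. f \<in> (BMO M :: ('a \<Rightarrow> 'b::{real_normed_field, euclidean_space}) set) \<longrightarrow> 0 < r \<longrightarrow> r < \<rho> x \<longrightarrow>
     mean_osc M (\<lambda>y. f y - kernel_op M K f y) (ball x r) \<le> ennreal C * BMO_norm M f"
proof -
  obtain R C where C: "0 \<le> C"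
    and near: "\<And>f z x. f \<in> (L1_loc M :: ('a \<Rightarrow> 'b) set) \<Longrightarrow> x \<in> ball z (1 * \<rho> z) \<Longrightarrow>
      ennreal (norm (kernel_op M K f x - avg M f (ball z (R * \<rho> z)))) \<le> ennreal C * BMO_norm M f"
    using kernel_op_near_avg[OF zero_le_one, where 'b='b] by blast
  have "mean_osc M (\<lambda>y. f y - kernel_op M K f y) (ball x r) \<le> ennreal (2 * (1 + C)) * BMO_norm M f"
    if f: "f \<in> BMO M" and r: "0 < r" "r < \<rho> x" for f :: "'a \<Rightarrow> 'b" and x r
  proof -
    let ?a = "avg M f (ball x r)" and ?b = "avg M f (ball x (R * \<rho> x))"
    have fL: "f \<in> L1_loc M" using f by (simp add: BMO_def)
    note meas = L1_locD(1)[OF fL] kernel_op_meas[OF L1_locD(1)[OF fL]]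
    have "mean_osc M (\<lambda>y. f y - kernel_op M K f y) (ball x r)
        \<le> 2 * mean_abs M (\<lambda>y. f y - kernel_op M K f y - (?a - ?b)) (ball x r)"
      by (rule mean_osc_le[OF r(1) diff_kernel_op_L1_loc[OF f]])
    also have "\<dots> \<le> 2 * (mean_abs M (\<lambda>y. f y - ?a) (ball x r) + mean_abs M (\<lambda>y. kernel_op M K f y - ?b) (ball x r))"
    proof (intro mult_left_mono mean_abs_triangle)
      show "norm (f y - kernel_op M K f y - (?a - ?b)) \<le> norm (f y - ?a) + norm (kernel_op M K f y - ?b)" for y
        using norm_triangle_ineq4[of "f y - ?a" "kernel_op M K f y - ?b"] by (simp add: algebra_simps)
    qed (use meas in \<open>simp_all, measurable\<close>)
    also have "\<dots> \<le> 2 * (BMO_norm M f + ennreal C * BMO_norm M f)"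
    proof (intro mult_left_mono add_mono)
      show "mean_abs M (\<lambda>y. f y - ?a) (ball x r) \<le> BMO_norm M f"
        using mean_osc_le_BMO_norm[OF r(1), of f x] by (simp add: mean_osc_def)
      show "mean_abs M (\<lambda>y. kernel_op M K f y - ?b) (ball x r) \<le> ennreal C * BMO_norm M f"
        using r(2) by (intro mean_abs_le_bound r(1) near[OF fL]) auto
    qed auto
    also have "\<dots> = ennreal (2 * (1 + C)) * BMO_norm M f"
      using C by (simp add: ennreal_mult ennreal_plus distrib_right distrib_left mult.assoc)
    finally show ?thesis .
  qed
  moreover have "0 \<le> 2 * (1 + C)" using C by simp
  ultimately show ?thesis by blast
qed

lemma diff_kernel_op_BMO_rho_norm_le:
  "\<exists>C>0. \<forall>f \<in> (BMO M :: ('a \<Rightarrow> 'b::{real_normed_field, euclidean_space}) set).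
     BMO_rho_norm M \<rho> (\<lambda>x. f x - kernel_op M K f x) \<le> ennreal C * BMO_norm M f"
proof -
  obtain C where C: "0 \<le> C" and super: "\<And>f x r. f \<in> (L1_loc M :: ('a \<Rightarrow> 'b) set) \<Longrightarrow> \<rho> x \<le> r \<Longrightarrow>
     mean_abs M (\<lambda>y. f y - kernel_op M K f y) (ball x r) \<le> ennreal C * BMO_norm M f"
    using diff_kernel_op_supercritical[where 'b='b] by auto
  obtain C' where C': "0 \<le> C'" and sub: "\<And>f x r. f \<in> (BMO M :: ('a \<Rightarrow> 'b) set) \<Longrightarrow> 0 < r \<Longrightarrow> r < \<rho> x \<Longrightarrow>
     mean_osc M (\<lambda>y. f y - kernel_op M K f y) (ball x r) \<le> ennreal C' * BMO_norm M f"
    using diff_kernel_op_subcritical[where 'b='b] by auto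
  have "BMO_rho_norm M \<rho> (\<lambda>x. f x - kernel_op M K f x) \<le> ennreal (C' + C + 1) * BMO_norm M f"
    if f: "f \<in> BMO M" for f :: "'a \<Rightarrow> 'b"
  proof -
    have "BMO_rho_norm M \<rho> (\<lambda>x. f x - kernel_op M K f x) \<le> ennreal C' * BMO_norm M f + ennreal C * BMO_norm M f"
      using f by (intro BMO_rho_norm_le sub super) (auto simp: BMO_def)
    also have "\<dots> = ennreal (C' + C) * BMO_norm M f"
      using C C' by (simp add: distrib_right ennreal_plus)
    also have "\<dots> \<le> ennreal (C' + C + 1) * BMO_norm M f"
      by (intro mult_right_mono ennreal_leI) auto
    finally show ?thesis .
  qed
  moreover have "0 < C' + C + 1" using C C' by simp
  ultimately show ?thesis by blast
qed

lemma mean_abs_le_Linf_norm: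
  assumes "0 < r"
  shows "mean_abs M g (ball x r) \<le> Linf_norm M g"
proof -
  have "AE y in M. ennreal (norm (g y)) \<le> Linf_norm M g"
    unfolding Linf_norm_def by (rule esssup_AE)
  then have "(\<integral>\<^sup>+y\<in>ball x r. ennreal (norm (g y)) \<partial>M) \<le> (\<integral>\<^sup>+y\<in>ball x r. Linf_norm M g \<partial>M)"
    by (intro nn_integral_mono_AE) (auto elim!: eventually_mono simp: indicator_def)
  also have "\<dots> = Linf_norm M g * emeasure M (ball x r)" by (simp add: nn_integral_cmult_indicator)
  finally show ?thesis by (simp add: mean_abs_le_iff[OF assms])
qed

lemma BMO_rho_norm_le_kernel_op:
  "\<exists>C\<ge>1. \<forall>f \<in> (BMO M :: ('a \<Rightarrow> 'b::{real_normed_field, euclidean_space}) set).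
     BMO_rho_norm M \<rho> f \<le> ennreal C * (Linf_norm M (kernel_op M K f) + BMO_norm M f)"
proof -
  obtain C where C: "0 \<le> C" and super: "\<And>f x r. f \<in> (L1_loc M :: ('a \<Rightarrow> 'b) set) \<Longrightarrow> \<rho> x \<le> r \<Longrightarrow>
     mean_abs M (\<lambda>y. f y - kernel_op M K f y) (ball x r) \<le> ennreal C * BMO_norm M f"
    using diff_kernel_op_supercritical[where 'b='b] by auto
  have "BMO_rho_norm M \<rho> f \<le> ennreal (1 + C) * (Linf_norm M (kernel_op M K f) + BMO_norm M f)"
    if "f \<in> BMO M" for f :: "'a \<Rightarrow> 'b"
  proof -
    have f: "f \<in> L1_loc M" using that by (simp add: BMO_def)
    note meas = L1_locD(1)[OF f] kernel_op_meas[OF L1_locD(1)[OF f]]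
    have "BMO_rho_norm M \<rho> f \<le> BMO_norm M f + (ennreal C * BMO_norm M f + Linf_norm M (kernel_op M K f))"
    proof (rule BMO_rho_norm_le)
      fix x r assume r: "\<rho> x \<le> r"
      have "mean_abs M f (ball x r)
          \<le> mean_abs M (\<lambda>y. f y - kernel_op M K f y) (ball x r) + mean_abs M (kernel_op M K f) (ball x r)"
      proof (rule mean_abs_triangle)
        show "norm (f y) \<le> norm (f y - kernel_op M K f y) + norm (kernel_op M K f y)" for y
          using norm_triangle_ineq[of "f y - kernel_op M K f y" "kernel_op M K f y"] by simp
      qed (use meas in measurable)
      also have "\<dots> \<le> ennreal C * BMO_norm M f + Linf_norm M (kernel_op M K f)"
        using r \<rho>_pos[of x] by (intro add_mono super f mean_abs_le_Linf_norm) auto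
      finally show "mean_abs M f (ball x r) \<le> ennreal C * BMO_norm M f + Linf_norm M (kernel_op M K f)" .
    qed (rule mean_osc_le_BMO_norm)
    also have "\<dots> = ennreal (1 + C) * BMO_norm M f + ennreal 1 * Linf_norm M (kernel_op M K f)"
      using C by (simp add: distrib_right ennreal_plus add.assoc)
    also have "\<dots> \<le> ennreal (1 + C) * BMO_norm M f + ennreal (1 + C) * Linf_norm M (kernel_op M K f)"
      using C by (intro add_left_mono mult_right_mono ennreal_leI) auto
    finally show ?thesis by (simp add: distrib_left add.commute)
  qed
  moreover have "1 \<le> 1 + C" using C by simp
  ultimately show ?thesis by blast
qed

end

section \<open>The characterization of the local BMO space\<close>

theorem corollary3p1:
  fixes M :: "'a::metric_space measure"
    and \<rho> :: "'a \<Rightarrow> real"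
    and K :: "'a \<Rightarrow> 'a \<Rightarrow> real"
    and C5 :: real
  assumes "rd_space M"
    and "admissible \<rho>"
    and "case_prod K \<in> borel_measurable (M \<Otimes>\<^sub>M M)"
    and "\<And>x y. 0 \<le> K x y"
    and "0 < C5"
    and K1: "\<And>x y. dist x y > C5 * min (\<rho> x) (\<rho> y) \<Longrightarrow> K x y = 0"
    and K2: "\<And>x y. K x y \<le> C5 * (1 / (measure M (ball x (\<rho> x)) + measure M (ball y (\<rho> y))))"
    and K3: "\<And>x y. K x y = K y x"
    and K4: "\<And>y. (LINT x|M. K x y) = 1"
  shows
    "((BMO_rho M \<rho> :: ('a \<Rightarrow> 'b::{real_normed_field, euclidean_space}) set) =
        {b \<in> BMO M. kernel_op M K b \<in> Linf M} \<and>
      (\<exists>C::real. C \<ge> 1 \<and> (\<forall>b \<in> (BMO_rho M \<rho> :: ('a \<Rightarrow> 'b) set).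
         ennreal (1 / C) * BMO_rho_norm M \<rho> b
           \<le> Linf_norm M (kernel_op M K b) + BMO_norm M b \<and>
         Linf_norm M (kernel_op M K b) + BMO_norm M b
           \<le> ennreal C * BMO_rho_norm M \<rho> b))) \<and>
     ((\<forall>f \<in> (BMO M :: ('a \<Rightarrow> 'b) set). (\<lambda>x. f x - kernel_op M K f x) \<in> BMO_rho M \<rho>) \<and>
      (\<exists>C::real. C > 0 \<and> (\<forall>f \<in> (BMO M :: ('a \<Rightarrow> 'b) set).
         BMO_rho_norm M \<rho> (\<lambda>x. f x - kernel_op M K f x) \<le> ennreal C * BMO_norm M f)))"
proof -
  have sets: "sets M = sets borel"
    using assms(1) by (simp add: rd_space_def regular_borel_def)
  have balls: "0 < emeasure M (ball x r)" "emeasure M (ball x r) < \<infinity>" if "0 < r" for x r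
    using assms(1) that by (auto simp: rd_space_def)
  have eq: "emeasure M (ball x r) = ennreal (measure M (ball x r))" if "0 < r" for x r
    using balls(2)[OF that, of x] by (intro emeasure_eq_ennreal_measure) auto
  obtain D where D: "1 \<le> D" "\<And>x r. 0 < r \<Longrightarrow> measure M (ball x (2 * r)) \<le> D * measure M (ball x r)"
    using assms(1) unfolding rd_space_def by blast
  have dbl: "emeasure M (ball x (2 * r)) \<le> ennreal D * emeasure M (ball x r)" if "0 < r" for x r
    using D(1) D(2)[OF that, of x] that
    by (simp add: eq ennreal_mult[symmetric] ennreal_leI)
  obtain C0 k0 where adm: "0 < C0" "0 < k0"
      "\<And>x y. 1 / \<rho> x \<le> C0 * (1 / \<rho> y) * (1 + dist x y / \<rho> y) powr k0" and pos: "\<And>x. 0 < \<rho> x"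
    using assms(2) unfolding admissible_def by blast
  interpret critical_kernel M D \<rho> C0 k0 K C5
    by unfold_locales (fact sets balls D(1) dbl pos adm assms(3-5) K1 K2 K3 K4)+
  obtain A where A: "0 \<le> A" and Linf_le: "\<And>f. f \<in> (L1_loc M :: ('a \<Rightarrow> 'b) set) \<Longrightarrow>
      Linf_norm M (kernel_op M K f) \<le> ennreal A * BMO_rho_norm M \<rho> f"
    using kernel_op_Linf_norm_le[where 'b='b] by auto
  obtain B where B: "1 \<le> B" and rho_le: "\<And>f. f \<in> (BMO M :: ('a \<Rightarrow> 'b) set) \<Longrightarrow>
      BMO_rho_norm M \<rho> f \<le> ennreal B * (Linf_norm M (kernel_op M K f) + BMO_norm M f)"
    using BMO_rho_norm_le_kernel_op[where 'b='b] by auto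
  obtain E where E: "0 < E" and diff_le: "\<And>f. f \<in> (BMO M :: ('a \<Rightarrow> 'b) set) \<Longrightarrow>
      BMO_rho_norm M \<rho> (\<lambda>x. f x - kernel_op M K f x) \<le> ennreal E * BMO_norm M f"
    using diff_kernel_op_BMO_rho_norm_le[where 'b='b] by auto
  have upper: "Linf_norm M (kernel_op M K b) + BMO_norm M b \<le> ennreal (A + 2) * BMO_rho_norm M \<rho> b"
    if "b \<in> L1_loc M" for b :: "'a \<Rightarrow> 'b"
    using add_mono[OF Linf_le[OF that] BMO_norm_le_BMO_rho_norm[OF that]] A
    by (simp add: ennreal_plus distrib_right)
  have sub: "b \<in> BMO M" "kernel_op M K b \<in> Linf M" if "b \<in> BMO_rho M \<rho>" for b :: "'a \<Rightarrow> 'b"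
  proof -
    have b: "b \<in> L1_loc M" "BMO_rho_norm M \<rho> b < \<infinity>" using that by (auto simp: BMO_rho_def)
    have "Linf_norm M (kernel_op M K b) + BMO_norm M b < \<infinity>"
      by (rule le_less_trans[OF upper[OF b(1)]]) (use b(2) in \<open>simp add: ennreal_mult_less_top\<close>)
    then show "b \<in> BMO M" "kernel_op M K b \<in> Linf M"
      using b(1) kernel_op_meas[OF L1_locD(1)[OF b(1)]] by (auto simp: BMO_def Linf_def)
  qed
  have sup: "b \<in> BMO_rho M \<rho>" if "b \<in> BMO M" "kernel_op M K b \<in> Linf M" for b :: "'a \<Rightarrow> 'b"
  proof -
    have "BMO_rho_norm M \<rho> b < \<infinity>"
      using rho_le[OF that(1)] that
      by (rule_tac le_less_trans) (auto simp: ennreal_mult_less_top BMO_def Linf_def)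
    then show ?thesis using that(1) by (simp add: BMO_rho_def BMO_def)
  qed
  define C where "C = max B (A + 2)"
  have C: "1 \<le> C" "B \<le> C" "A + 2 \<le> C" using B by (auto simp: C_def)
  have lower: "ennreal (1 / C) * BMO_rho_norm M \<rho> b \<le> Linf_norm M (kernel_op M K b) + BMO_norm M b"
    if "b \<in> BMO M" for b :: "'a \<Rightarrow> 'b"
  proof -
    let ?s = "Linf_norm M (kernel_op M K b) + BMO_norm M b"
    have "ennreal (1 / C) * BMO_rho_norm M \<rho> b \<le> ennreal (1 / C) * (ennreal C * ?s)"
      using C by (intro mult_left_mono order_trans[OF rho_le[OF that]] mult_right_mono ennreal_leI) auto
    also have "\<dots> = ennreal (1 / C * C) * ?s" using C by (simp add: ennreal_mult mult.assoc del: times_divide_eq_left)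
    finally show ?thesis using C by simp
  qed
  have two_sided: "ennreal (1 / C) * BMO_rho_norm M \<rho> b \<le> Linf_norm M (kernel_op M K b) + BMO_norm M b \<and>
      Linf_norm M (kernel_op M K b) + BMO_norm M b \<le> ennreal C * BMO_rho_norm M \<rho> b"
    if b: "b \<in> BMO_rho M \<rho>" for b :: "'a \<Rightarrow> 'b"
  proof
    show "ennreal (1 / C) * BMO_rho_norm M \<rho> b \<le> Linf_norm M (kernel_op M K b) + BMO_norm M b"
      by (rule lower[OF sub(1)[OF b]])
    have "Linf_norm M (kernel_op M K b) + BMO_norm M b \<le> ennreal (A + 2) * BMO_rho_norm M \<rho> b"
      using b by (intro upper) (simp add: BMO_rho_def)
    also have "\<dots> \<le> ennreal C * BMO_rho_norm M \<rho> b" using C by (intro mult_right_mono ennreal_leI) auto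
    finally show "Linf_norm M (kernel_op M K b) + BMO_norm M b \<le> ennreal C * BMO_rho_norm M \<rho> b" .
  qed
  have diff_mem: "(\<lambda>x. f x - kernel_op M K f x) \<in> BMO_rho M \<rho>" if f: "f \<in> BMO M" for f :: "'a \<Rightarrow> 'b"
  proof -
    have "ennreal E * BMO_norm M f < \<infinity>" using f by (simp add: BMO_def ennreal_mult_less_top)
    then show ?thesis
      using le_less_trans[OF diff_le[OF f]] diff_kernel_op_L1_loc[OF f] by (simp add: BMO_rho_def)
  qed
  have "(BMO_rho M \<rho> :: ('a \<Rightarrow> 'b) set) = {b \<in> BMO M. kernel_op M K b \<in> Linf M}"
    using sub sup by blast
  then show ?thesis using C(1) two_sided E diff_le diff_mem by blast
qed

end
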